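(* Let $\gamma\ge0$, $p,N\in\mathbb{R}$ and let $n\ge0$ be an integer such that one of the following holds: (i) $p<0$ and $N-\gamma<0$; (ii) $0<p<1$ and $n\in\{0,1,\dots,\lfloor N-\gamma\rfloor\}$; (iii) $p>1$ and $N-\gamma<0$. Then, as polynomials in $x$, $$\mathscr{K}_n(x;p,N,\gamma)=\frac{(\gamma+1)_n}{n!}\sum_{k=0}^{n}p^{-k}\frac{(-n)_k(\gamma-x)_k}{(\gamma+1)_k(\gamma-N)_k}\;{}_4F_3\left(\begin{array}{c}k-n,\ \gamma-x+k,\ \gamma-N-1,\ \gamma\\ \gamma-x,\ \gamma-N+k,\ \gamma+1+k\end{array}\Big|\,1\right).$$
   Context: The associated Krawtchouk polynomials $\mathscr{K}_n(x;p,N,\gamma)$ are defined by $\mathscr{K}_{-1}=0$, $\mathscr{K}_0=1$ and $$p(N-n-\gamma)\,\mathscr{K}_{n+1}(x;p,N,\gamma)=[pN+(n+\gamma)(1-2p)-x]\,\mathscr{K}_n(x;p,N,\gamma)-(n+\gamma)(1-p)\,\mathscr{K}_{n-1}(x;p,N,\gamma)$$ for $n\ge0$ as long as $N-n-\gamma\neq0$. $\lfloor\cdot\rfloor$ is the floor function. Pochhammer symbol: $(b)_0=1$, $(b)_k=b(b+1)\cdots(b+k-1)$. The terminating series is ${}_4F_3\left(\begin{array}{c}k-n,a_2,a_3,a_4\\ b_1,b_2,b_3\end{array}\Big|1\right)=\sum_{j=0}^{n-k}\frac{(k-n)_j(a_2)_j(a_3)_j(a_4)_j}{(b_1)_j(b_2)_j(b_3)_j\,j!}$.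 Convention: the factor $(\gamma-x)_k(\gamma-x+k)_j/(\gamma-x)_j$ in each term is a polynomial in $x$ (equal to $(\gamma-x+j)_k$), so at the finitely many $x$ where $(\gamma-x)_j$ vanishes the right-hand side is understood by continuity in $x$. *)

theory Defs
  imports Complex_Main "HOL-Computational_Algebra.Polynomial"
begin

(* The recurrence solved for its leading term, as polynomials in x; the "if" encodes K_{-1} = 0.
   If p (N - m - \<gamma>) = 0 for some m < n, the mathematical K_n is undefined and the value here is
   meaningless (division by zero is zero). *)
fun assoc_krawtchouk :: "real \<Rightarrow> real \<Rightarrow> real \<Rightarrow> nat \<Rightarrow> real poly" where
  "assoc_krawtchouk p N \<gamma> 0 = 1"
| "assoc_krawtchouk p N \<gamma> (Suc n) =
     smult (1 / (p * (N - real n - \<gamma>)))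
       ([:p * N + (real n + \<gamma>) * (1 - 2 * p), -1:] * assoc_krawtchouk p N \<gamma> n
        - smult ((real n + \<gamma>) * (1 - p))
            (if n = 0 then 0 else assoc_krawtchouk p N \<gamma> (n - 1)))"

lemma assoc_krawtchouk_recurrence:
  assumes "p \<noteq> 0" and "N - real n - \<gamma> \<noteq> 0"
  shows "p * (N - real n - \<gamma>) * poly (assoc_krawtchouk p N \<gamma> (Suc n)) x =
    (p * N + (real n + \<gamma>) * (1 - 2 * p) - x) * poly (assoc_krawtchouk p N \<gamma> n) x
    - (real n + \<gamma>) * (1 - p) * (if n = 0 then 0 else poly (assoc_krawtchouk p N \<gamma> (n - 1)) x)"
  using assms by (simp del: mult_pCons_left)

(* The terminating series 4F3(-m, a2, a3, a4; b1, b2, b3 | 1). *)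
definition terminating_4F3 ::
    "nat \<Rightarrow> real \<Rightarrow> real \<Rightarrow> real \<Rightarrow> real \<Rightarrow> real \<Rightarrow> real \<Rightarrow> real" where
  "terminating_4F3 m a2 a3 a4 b1 b2 b3 =
     (\<Sum>j=0..m. (pochhammer (- real m) j * pochhammer a2 j * pochhammer a3 j * pochhammer a4 j)
              / (pochhammer b1 j * pochhammer b2 j * pochhammer b3 j * fact j))"

end

(* Collect the double sum along m = k + j.  It becomes the sum over m of c(n,m) Q_m(x), where c is
   elementary and Q_m satisfies the first-order recurrence p Q_{m+1} = (gamma - x + m) Q_m + p r_{m+1}.
   Substituting this for x Q_m in the three-term recurrence, the coefficient of each Q_m vanishes
   except at m = 0, and what remains there cancels against the sum of the r_{m+1} because
   sum_m (-n)_m / (m+1)! = 1 / (n+1). *)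
theory Submission
  imports Defs
begin

section \<open>Coefficients c(n,m) and basis functions Q_m of the collected double sum\<close>

text \<open>The parameter \<open>a\<close> stands for \<open>\<gamma> - N\<close>. This factor
  collects whatever depends on k and j only through m = k + j, for instance (-n)_k (k-n)_j =
  (-n)_m.\<close>

definition krawtchouk_coeff :: "real \<Rightarrow> real \<Rightarrow> nat \<Rightarrow> nat \<Rightarrow> real" where
  "krawtchouk_coeff \<gamma> a n m =
     pochhammer (\<gamma> + 1) n / fact n * pochhammer (- real n) m / (pochhammer (\<gamma> + 1) m * pochhammer a m)"

text \<open>Here k = m - j. The quotient (\<gamma>-x)_k (\<gamma>-x+k)_j / (\<gamma>-x)_j enters in
  its polynomial form (\<gamma>-x+j)_k, so the value is the right one at the exceptional x too. The
  last factor is r_j.\<close>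

definition krawtchouk_basis :: "real \<Rightarrow> real \<Rightarrow> real \<Rightarrow> real \<Rightarrow> nat \<Rightarrow> real" where
  "krawtchouk_basis p \<gamma> a x m =
     (\<Sum>j\<le>m. (1 / p) ^ (m - j) * pochhammer (\<gamma> - x + real j) (m - j)
              * (pochhammer (a - 1) j * pochhammer \<gamma> j / fact j))"

text \<open>Passing from m to m + 1 multiplies each term with j \<le> m by (\<gamma> - x + m) / p,
  since (\<gamma>-x+j)_(m-j) gains the last factor \<gamma> - x + m. The one new term, j = m + 1, is
  r_(m+1).\<close>

lemma krawtchouk_basis_Suc:
  assumes "p \<noteq> 0"
  shows "(\<gamma> - x + real m) * krawtchouk_basis p \<gamma> a x m =
    p * (krawtchouk_basis p \<gamma> a x (Suc m) - pochhammer (a - 1) (Suc m) * pochhammer \<gamma> (Suc m) / fact (Suc m))"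
proof -
  let ?r = "\<lambda>j. pochhammer (a - 1) j * pochhammer \<gamma> j / fact j"
  have "p * (krawtchouk_basis p \<gamma> a x (Suc m) - ?r (Suc m)) =
      p * (\<Sum>j\<le>m. (1 / p) ^ (Suc m - j) * pochhammer (\<gamma> - x + real j) (Suc m - j) * ?r j)"
    unfolding krawtchouk_basis_def sum.atMost_Suc by simp
  also have "\<dots> = (\<Sum>j\<le>m. (\<gamma> - x + real m) *
      ((1 / p) ^ (m - j) * pochhammer (\<gamma> - x + real j) (m - j) * ?r j))"
    unfolding sum_distrib_left
  proof (rule sum.cong[OF refl])
    fix j assume "j \<in> {..m}"
    then have *: "Suc m - j = Suc (m - j)" "real j + real (m - j) = real m" by auto
    show "p * ((1 / p) ^ (Suc m - j) * pochhammer (\<gamma> - x + real j) (Suc m - j) * ?r j) =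
        (\<gamma> - x + real m) * ((1 / p) ^ (m - j) * pochhammer (\<gamma> - x + real j) (m - j) * ?r j)"
      unfolding * pochhammer_Suc[of _ "m - j"] add.assoc power_Suc using assms by simp
  qed
  also have "\<dots> = (\<gamma> - x + real m) * krawtchouk_basis p \<gamma> a x m"
    unfolding krawtchouk_basis_def sum_distrib_left ..
  finally show ?thesis ..
qed

section \<open>Contiguous relations for c(n,m)\<close>

lemma pochhammer_minus_Suc_shift:
  "pochhammer (- real (Suc n)) (Suc m) = - real (Suc n) * pochhammer (- real n) m"
  by (simp add: pochhammer_rec)

text \<open>Splitting (-n-1)_(m+1) at its first and at its last factor relates (-n)_m to (-n-1)_m.
  Leaving n + 1 - m undivided keeps the case m = n + 1.\<close>

lemma krawtchouk_coeff_pred: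
  "(real (Suc n) - real m) * krawtchouk_coeff \<gamma> a (Suc n) m = (real (Suc n) + \<gamma>) * krawtchouk_coeff \<gamma> a n m"
proof -
  have "pochhammer (- real (Suc n)) m * (real (Suc n) - real m) = real (Suc n) * pochhammer (- real n) m"
    using pochhammer_minus_Suc_shift[of n m] by (simp add: pochhammer_Suc algebra_simps)
  then have "pochhammer (- real (Suc n)) m * (real (Suc n) - real m) / real (Suc n) = pochhammer (- real n) m"
    by (simp add: field_simps)
  moreover have "(real (Suc n) - real m) * krawtchouk_coeff \<gamma> a (Suc n) m =
      (real (Suc n) + \<gamma>) * (pochhammer (\<gamma> + 1) n / fact n)
      * (pochhammer (- real (Suc n)) m * (real (Suc n) - real m) / real (Suc n))
      / (pochhammer (\<gamma> + 1) m * pochhammer a m)"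
    unfolding krawtchouk_coeff_def pochhammer_Suc[of "\<gamma> + 1"] fact_Suc by (simp add: add.commute[of \<gamma>] mult_ac)
  ultimately show ?thesis
    by (simp add: krawtchouk_coeff_def)
qed

text \<open>With q(t) = (\<gamma> + 1 + t)(a + t), the claim reduces to q(m) - q(n) = (m - n)(a + n
  + m + 1 + \<gamma>). It cancels the coefficient of Q_(m+1) in the three-term recurrence.\<close>

lemma krawtchouk_coeff_Suc_Suc:
  assumes "\<gamma> \<ge> 0" "a + real m \<noteq> 0"
  shows "(a + real n) * krawtchouk_coeff \<gamma> a (Suc n) (Suc m) + krawtchouk_coeff \<gamma> a n m =
    (a + real n + real (Suc m) + \<gamma>) * krawtchouk_coeff \<gamma> a n (Suc m)"
proof -
  define B where "B = pochhammer (\<gamma> + 1) n / fact n * pochhammer (- real n) m / (pochhammer (\<gamma> + 1) m * pochhammer a m)"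
  \<comment> \<open>\<open>B\<close> is c(n,m) unfolded, and \<open>d\<close> is the factor that its
    denominator gains when m increases by one.\<close>
  define d where "d = (\<gamma> + 1 + real m) * (a + real m)"
  have d: "d \<noteq> 0" using assms by (auto simp: d_def)
  have "krawtchouk_coeff \<gamma> a (Suc n) (Suc m) = - ((\<gamma> + 1 + real n) * B) / d"
    unfolding krawtchouk_coeff_def pochhammer_minus_Suc_shift pochhammer_Suc[of "\<gamma> + 1"] pochhammer_Suc[of a] B_def d_def fact_Suc
    by (simp add: mult_ac del: of_nat_Suc)
  moreover have "krawtchouk_coeff \<gamma> a n (Suc m) = (real m - real n) * B / d"
    unfolding krawtchouk_coeff_def pochhammer_Suc B_def d_def by (simp add: mult_ac)
  moreover have "krawtchouk_coeff \<gamma> a n m = B * d / d"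
    using d by (simp add: krawtchouk_coeff_def B_def)
  moreover have "(a + real n) * - ((\<gamma> + 1 + real n) * B) + B * d =
      (a + real n + real (Suc m) + \<gamma>) * ((real m - real n) * B)"
    by (simp add: d_def algebra_simps)
  ultimately show ?thesis
    by (metis add_divide_distrib times_divide_eq_right)
qed

text \<open>At m = 0 there is no c(n,m-1) to compensate, and the last summand is the defect that
  remains. It comes from \<gamma>(a + n) = \<gamma>(n + 1) + \<gamma>(a - 1).\<close>

lemma krawtchouk_coeff_Suc_0:
  "(a + real n) * krawtchouk_coeff \<gamma> a (Suc n) 0 =
    (a + real n + \<gamma>) * krawtchouk_coeff \<gamma> a n 0 + \<gamma> * (a - 1) / real (Suc n) * krawtchouk_coeff \<gamma> a n 0"
proof -
  have "krawtchouk_coeff \<gamma> a (Suc n) 0 = (\<gamma> + 1 + real n) / real (Suc n) * krawtchouk_coeff \<gamma> a n 0"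
    by (simp add: krawtchouk_coeff_def pochhammer_Suc mult_ac)
  moreover have "(a + real n) * ((\<gamma> + 1 + real n) / real (Suc n)) = (a + real n + \<gamma>) + \<gamma> * (a - 1) / real (Suc n)"
    by (simp add: field_simps)
  ultimately show ?thesis
    by (metis mult.assoc distrib_right)
qed

lemma krawtchouk_coeff_Suc_self [simp]: "krawtchouk_coeff \<gamma> a n (Suc n) = 0"
  by (simp add: krawtchouk_coeff_def pochhammer_of_nat_eq_0_lemma)

section \<open>The sum of c(n,m) r_(m+1)\<close>

text \<open>The hockey-stick identity: (b)_m / m! is the binomial coefficient of b + m - 1 over m.
  The induction step uses (b)_(M+1) = b (b+1)_M.\<close>

lemma sum_pochhammer_div_fact:
  fixes b :: real
  shows "(\<Sum>m\<le>M. pochhammer b m / fact m) = pochhammer (b + 1) M / fact M"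
proof (induction M)
  case (Suc M)
  have "(b + 1 + real M) / real (Suc M) = 1 + b / real (Suc M)"
    by (simp add: field_simps)
  then have "pochhammer (b + 1) M / fact M * ((b + 1 + real M) / real (Suc M)) =
      pochhammer (b + 1) M / fact M + b * pochhammer (b + 1) M / (fact M * real (Suc M))"
    by (simp add: distrib_left)
  then show ?case
    using Suc.IH by (simp add: pochhammer_rec[of b] pochhammer_Suc[of "b + 1"] mult_ac)
qed simp

lemma sum_pochhammer_minus_div_fact_Suc:
  "(\<Sum>m\<le>n. pochhammer (- real n) m / fact (Suc m)) = 1 / real (Suc n)"
proof -
  \<comment> \<open>With b = -(n+1) and M = n + 1 the closed form contains (-n)_(n+1) = 0. Splitting
    off the term 1 at m = 0 leaves a multiple of the wanted sum.\<close>
  have "0 = (\<Sum>m\<le>Suc n. pochhammer (- real (Suc n)) m / fact m)"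
    unfolding sum_pochhammer_div_fact by (simp add: pochhammer_of_nat_eq_0_lemma)
  also have "\<dots> = 1 + (\<Sum>m\<le>n. pochhammer (- real (Suc n)) (Suc m) / fact (Suc m))"
    unfolding sum.atMost_Suc_shift by simp
  also have "\<dots> = 1 - real (Suc n) * (\<Sum>m\<le>n. pochhammer (- real n) m / fact (Suc m))"
    unfolding pochhammer_minus_Suc_shift sum_distrib_left by (simp add: sum_negf del: of_nat_Suc fact_Suc)
  finally show ?thesis by (simp add: field_simps del: fact_Suc)
qed

text \<open>Since (a-1)_(m+1) = (a-1)(a)_m and (\<gamma>)_(m+1) = \<gamma>(\<gamma>+1)_m, the
  denominators of c(n,m) cancel, and the sum of (-n)_m / (m+1)! remains. The value is exactly the
  defect in \<open>krawtchouk_coeff_Suc_0\<close>.\<close>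

lemma sum_krawtchouk_coeff:
  assumes "\<gamma> \<ge> 0" "\<And>i. i \<le> n \<Longrightarrow> a + real i \<noteq> 0"
  shows "(\<Sum>m\<le>n. krawtchouk_coeff \<gamma> a n m * (pochhammer (a - 1) (Suc m) * pochhammer \<gamma> (Suc m) / fact (Suc m)))
    = \<gamma> * (a - 1) / real (Suc n) * krawtchouk_coeff \<gamma> a n 0"
proof -
  have "krawtchouk_coeff \<gamma> a n m * (pochhammer (a - 1) (Suc m) * pochhammer \<gamma> (Suc m) / fact (Suc m))
      = \<gamma> * (a - 1) * krawtchouk_coeff \<gamma> a n 0 * (pochhammer (- real n) m / fact (Suc m))" if "m \<le> n" for m
  proof -
    have "pochhammer (\<gamma> + 1) m > 0" using assms(1) by (intro pochhammer_pos) auto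
    moreover have "pochhammer a m \<noteq> 0"
      proof
      assume "pochhammer a m = 0"
      then obtain i where "i < m" "a = - real i" by (auto simp: pochhammer_eq_0_iff)
      then show False using assms(2)[of i] that by simp
    qed
    ultimately show ?thesis
      by (simp add: krawtchouk_coeff_def pochhammer_rec[of "a - 1"] pochhammer_rec[of \<gamma>] del: fact_Suc)
  qed
  then have "(\<Sum>m\<le>n. krawtchouk_coeff \<gamma> a n m * (pochhammer (a - 1) (Suc m) * pochhammer \<gamma> (Suc m) / fact (Suc m)))
    = \<gamma> * (a - 1) * krawtchouk_coeff \<gamma> a n 0 * (\<Sum>m\<le>n. pochhammer (- real n) m / fact (Suc m))"
    unfolding sum_distrib_left by (intro sum.cong) auto
  then show ?thesis
    unfolding sum_pochhammer_minus_div_fact_Suc by simp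
qed

section \<open>The three-term recurrence for the collected sum\<close>

definition krawtchouk_sum :: "real \<Rightarrow> real \<Rightarrow> real \<Rightarrow> nat \<Rightarrow> real \<Rightarrow> real" where
  "krawtchouk_sum p \<gamma> a n x = (\<Sum>m\<le>n. krawtchouk_coeff \<gamma> a n m * krawtchouk_basis p \<gamma> a x m)"

text \<open>This is the defining recurrence of the polynomials with N = \<gamma> - a and all terms
  on one side; p(N - n - \<gamma>) becomes -p(a + n).\<close>

lemma krawtchouk_sum_recurrence:
  assumes p: "p \<noteq> 0" and g: "\<gamma> \<ge> 0" and a: "\<And>i. i \<le> n \<Longrightarrow> a + real i \<noteq> 0"
  shows "p * (a + real n) * krawtchouk_sum p \<gamma> a (Suc n) x
    + (\<gamma> - x + real n - p * (a + 2 * real n + \<gamma>)) * krawtchouk_sum p \<gamma> a n x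
    - (real n + \<gamma>) * (1 - p) * (if n = 0 then 0 else krawtchouk_sum p \<gamma> a (n - 1) x) = 0"
proof -
  let ?c = "krawtchouk_coeff \<gamma> a"
  let ?Q = "krawtchouk_basis p \<gamma> a x"
  let ?r = "\<lambda>m. pochhammer (a - 1) m * pochhammer \<gamma> m / fact m"
  \<comment> \<open>The value 0 at n = 0 mirrors K_(-1) = 0, so that one computation covers all
    n.\<close>
  define c' where "c' m = (if n = 0 then 0 else ?c (n - 1) m)" for m
  have c': "(real n + \<gamma>) * c' m = (real n - real m) * ?c n m" if "m \<le> Suc n" for m
  proof (cases n)
    case 0
    then show ?thesis using that by (cases m) (auto simp: c'_def)
  next
    case (Suc q)
    then show ?thesis using krawtchouk_coeff_pred[of q m \<gamma> a] by (simp add: c'_def)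
  qed
  have S: "krawtchouk_sum p \<gamma> a n x = (\<Sum>m\<le>n. ?c n m * ?Q m)"
    by (simp add: krawtchouk_sum_def)
  have S': "(if n = 0 then 0 else krawtchouk_sum p \<gamma> a (n - 1) x) = (\<Sum>m\<le>n. c' m * ?Q m)"
    by (cases n) (simp_all add: krawtchouk_sum_def c'_def)
  \<comment> \<open>The total contribution of index m, with (\<gamma> - x + m) Q_m already replaced
    by p (Q_(m+1) - r_(m+1)). The part (1 - p)(n - m) c(n,m) of the K_(n-1) term turns \<gamma> - x
    + n into \<gamma> - x + m and 2n into n + m.\<close>
  define E where "E m = p * (((a + real n) * ?c (Suc n) m - (a + real n + real m + \<gamma>) * ?c n m) * ?Q m
    + ?c n m * (?Q (Suc m) - ?r (Suc m)))" for m
  have E: "p * (a + real n) * (?c (Suc n) m * ?Q m)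
      + (\<gamma> - x + real n - p * (a + 2 * real n + \<gamma>)) * (?c n m * ?Q m)
      - (real n + \<gamma>) * (1 - p) * (c' m * ?Q m) = E m" if "m \<le> Suc n" for m
  proof -
    have "E m = p * (((a + real n) * ?c (Suc n) m - (a + real n + real m + \<gamma>) * ?c n m) * ?Q m)
      + ?c n m * ((\<gamma> - x + real m) * ?Q m)"
      unfolding krawtchouk_basis_Suc[OF p] E_def by (simp add: algebra_simps)
    moreover have "(real n + \<gamma>) * (1 - p) * (c' m * ?Q m) = (1 - p) * ((real n - real m) * ?c n m) * ?Q m"
      by (simp add: c'[OF that, symmetric])
    ultimately show ?thesis by (simp add: algebra_simps)
  qed
  \<comment> \<open>Only the sum for n + 1 reaches index n + 1. The other two contribute nothing
    there, so \<open>E (Suc n)\<close> is its top term.\<close>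
  have c'_top: "(real n + \<gamma>) * c' (Suc n) = 0"
    using c'[of "Suc n"] by simp
  have "p * (a + real n) * krawtchouk_sum p \<gamma> a (Suc n) x
    + (\<gamma> - x + real n - p * (a + 2 * real n + \<gamma>)) * krawtchouk_sum p \<gamma> a n x
    - (real n + \<gamma>) * (1 - p) * (if n = 0 then 0 else krawtchouk_sum p \<gamma> a (n - 1) x)
    = (\<Sum>m\<le>n. p * (a + real n) * (?c (Suc n) m * ?Q m)
      + (\<gamma> - x + real n - p * (a + 2 * real n + \<gamma>)) * (?c n m * ?Q m)
      - (real n + \<gamma>) * (1 - p) * (c' m * ?Q m)) + p * (a + real n) * (?c (Suc n) (Suc n) * ?Q (Suc n))"
    unfolding S S' unfolding krawtchouk_sum_def sum.atMost_Suc sum_subtractf sum.distrib sum_distrib_left[symmetric]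
    by (simp add: distrib_left)
  also have "\<dots> = (\<Sum>m\<le>n. E m) + E (Suc n)"
  proof (intro arg_cong2[where f = "(+)"] sum.cong refl)
    have "(real n + \<gamma>) * (1 - p) * (c' (Suc n) * ?Q (Suc n)) = (1 - p) * ((real n + \<gamma>) * c' (Suc n)) * ?Q (Suc n)"
      by (simp only: mult_ac)
    then show "p * (a + real n) * (?c (Suc n) (Suc n) * ?Q (Suc n)) = E (Suc n)"
      unfolding E[OF order_refl, symmetric] c'_top by simp
  qed (use E in auto)
  also have "\<dots> = (\<Sum>m\<le>Suc n. E m)" by simp
  also have "\<dots> = E 0 + (\<Sum>m\<le>n. E (Suc m))"
    by (rule sum.atMost_Suc_shift)
  \<comment> \<open>By the contiguous relation, the bracket in front of Q_(m+1) is just -c(n,m), so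
    the Q-terms telescope.\<close>
  also have "(\<Sum>m\<le>n. E (Suc m)) = (\<Sum>m\<le>n.
      p * (?c n (Suc m) * ?Q (Suc (Suc m))) - p * (?c n m * ?Q (Suc m)) - p * (?c n (Suc m) * ?r (Suc (Suc m))))"
  proof (rule sum.cong[OF refl])
    fix m assume "m \<in> {..n}"
    then have "(a + real n) * ?c (Suc n) (Suc m) - (a + real n + real (Suc m) + \<gamma>) * ?c n (Suc m) = - ?c n m"
      using krawtchouk_coeff_Suc_Suc[OF g a, of m n] by simp
    then show "E (Suc m) = p * (?c n (Suc m) * ?Q (Suc (Suc m))) - p * (?c n m * ?Q (Suc m)) - p * (?c n (Suc m) * ?r (Suc (Suc m)))"
      unfolding E_def by (simp add: right_diff_distrib)
  qed
  also have "\<dots> = p * ((\<Sum>m\<le>n. ?c n (Suc m) * ?Q (Suc (Suc m))) - (\<Sum>m\<le>n. ?c n m * ?Q (Suc m))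
      - (\<Sum>m\<le>n. ?c n (Suc m) * ?r (Suc (Suc m))))"
    unfolding sum_subtractf sum_distrib_left[symmetric] right_diff_distrib ..
  \<comment> \<open>The index shift costs only the term at 0, because c(n,n+1) = 0 at the upper end;
    likewise for the r-terms below.\<close>
  also have "(\<Sum>m\<le>n. ?c n (Suc m) * ?Q (Suc (Suc m))) = (\<Sum>m\<le>n. ?c n m * ?Q (Suc m)) - ?c n 0 * ?Q 1"
    using sum.atMost_Suc_shift[of "\<lambda>m. ?c n m * ?Q (Suc m)" n] by simp
  also have "(\<Sum>m\<le>n. ?c n (Suc m) * ?r (Suc (Suc m))) = (\<Sum>m\<le>n. ?c n m * ?r (Suc m)) - ?c n 0 * ?r 1"
    using sum.atMost_Suc_shift[of "\<lambda>m. ?c n m * ?r (Suc m)" n] by simp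
  also have "(\<Sum>m\<le>n. ?c n m * ?r (Suc m)) = \<gamma> * (a - 1) / real (Suc n) * ?c n 0"
    by (rule sum_krawtchouk_coeff[OF g a])
  also have "E 0 = p * (\<gamma> * (a - 1) / real (Suc n) * ?c n 0 + ?c n 0 * (?Q 1 - ?r 1))"
  proof -
    have "?Q 0 = 1" by (simp add: krawtchouk_basis_def)
    then show ?thesis
      unfolding E_def using krawtchouk_coeff_Suc_0[of a n \<gamma>] by simp
  qed
  \<comment> \<open>Here z is the defect at m = 0 and also the sum of the c(n,m) r_(m+1), c =
    c(n,0), q = Q_1, r = r_1, and A is the sum of the c(n,m) Q_(m+1).\<close>
  also have "p * (z + c * (q - r)) + p * (A - c * q - A - (z - c * r)) = 0" for z c q r A :: real
    by (simp add: algebra_simps)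
  finally show ?thesis .
qed

text \<open>Both sides start at 1 and obey the same recurrence, whose leading factors p(N - i -
  \<gamma>) are nonzero for i < n. The recurrence reaches back two steps, hence the strong
  induction.\<close>

lemma poly_assoc_krawtchouk_eq_sum:
  assumes p: "p \<noteq> 0" and g: "\<gamma> \<ge> 0" and "\<And>i. i < n \<Longrightarrow> \<gamma> - N + real i \<noteq> 0"
  shows "poly (assoc_krawtchouk p N \<gamma> n) x = krawtchouk_sum p \<gamma> (\<gamma> - N) n x"
  using assms(3)
proof (induction n rule: less_induct)
  case (less n)
  show ?case
  proof (cases n)
    case 0
    then show ?thesis
      by (simp add: krawtchouk_sum_def krawtchouk_coeff_def krawtchouk_basis_def)
  next
    case (Suc q)
    let ?S = "krawtchouk_sum p \<gamma> (\<gamma> - N)"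
    have a: "\<gamma> - N + real i \<noteq> 0" if "i \<le> q" for i
      using less.prems[of i] that Suc by simp
    then have nz: "N - real q - \<gamma> \<noteq> 0"
      using a[OF order_refl] by linarith
    have IH': "poly (assoc_krawtchouk p N \<gamma> i) x = ?S i x" if "i \<le> q" for i
    proof (rule less.IH)
      show "i < n" using that Suc by simp
      show "\<gamma> - N + real j \<noteq> 0" if "j < i" for j
        using less.prems[of j] that \<open>i < n\<close> by (simp del: assoc_krawtchouk.simps)
    qed
    have IH: "poly (assoc_krawtchouk p N \<gamma> q) x = ?S q x"
      "(if q = 0 then 0 else poly (assoc_krawtchouk p N \<gamma> (q - 1)) x) = (if q = 0 then 0 else ?S (q - 1) x)"
      using IH'[of q] IH'[of "q - 1"] by simp_all
    have "p * (N - real q - \<gamma>) * poly (assoc_krawtchouk p N \<gamma> (Suc q)) x = p * (N - real q - \<gamma>) * ?S (Suc q) x"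
      unfolding assoc_krawtchouk_recurrence[OF p nz] IH
      using krawtchouk_sum_recurrence[OF p g a, of q x] by (simp add: algebra_simps)
    then show ?thesis
      using p nz Suc by (simp del: assoc_krawtchouk.simps)
  qed
qed

section \<open>From the double sum to the collected sum\<close>

lemma pochhammer_add_shift: "pochhammer z k * pochhammer (z + real k) j = pochhammer z (k + j)" for z :: real
  by (simp add: pochhammer_product'[symmetric])

text \<open>Once the quotient by (\<gamma>-x)_j is cancelled, each term is c(n,k+j) times a term of
  Q_(k+j), and the triangle k + j \<le> n is summed along its diagonals.\<close>

lemma krawtchouk_sum_eq_4F3:
  assumes "\<And>j. j \<le> n \<Longrightarrow> pochhammer (\<gamma> - x) j \<noteq> 0"
  shows "pochhammer (\<gamma> + 1) n / fact n *
      (\<Sum>k=0..n. p powi (- int k)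
         * (pochhammer (- real n) k * pochhammer (\<gamma> - x) k) / (pochhammer (\<gamma> + 1) k * pochhammer a k)
         * terminating_4F3 (n - k) (\<gamma> - x + real k) (a - 1) \<gamma> (\<gamma> - x) (a + real k) (\<gamma> + 1 + real k))
    = krawtchouk_sum p \<gamma> a n x"
proof -
  let ?r = "\<lambda>j. pochhammer (a - 1) j * pochhammer \<gamma> j / fact j"
  let ?t = "\<lambda>k j. krawtchouk_coeff \<gamma> a n (k + j) * ((1 / p) ^ k * pochhammer (\<gamma> - x + real j) k * ?r j)"
  have inner: "pochhammer (\<gamma> + 1) n / fact n * (p powi (- int k)
         * (pochhammer (- real n) k * pochhammer (\<gamma> - x) k) / (pochhammer (\<gamma> + 1) k * pochhammer a k)
         * terminating_4F3 (n - k) (\<gamma> - x + real k) (a - 1) \<gamma> (\<gamma> - x) (a + real k) (\<gamma> + 1 + real k))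
    = (\<Sum>j\<le>n - k. ?t k j)" if k: "k \<le> n" for k
  proof -
    have pw: "p powi (- int k) = (1 / p) ^ k"
      by (simp add: power_int_minus power_one_over inverse_eq_divide)
    have summand: "pochhammer (\<gamma> + 1) n / fact n * ((1 / p) ^ k
         * (pochhammer (- real n) k * pochhammer (\<gamma> - x) k) / (pochhammer (\<gamma> + 1) k * pochhammer a k)
         * ((pochhammer (- real (n - k)) j * pochhammer (\<gamma> - x + real k) j * pochhammer (a - 1) j * pochhammer \<gamma> j)
            / (pochhammer (\<gamma> - x) j * pochhammer (a + real k) j * pochhammer (\<gamma> + 1 + real k) j * fact j)))
      = ?t k j" if j: "j \<le> n - k" for j
    proof -
      have u: "pochhammer (\<gamma> - x) j \<noteq> 0" using assms j by auto
      \<comment> \<open>Both sides equal (\<gamma>-x)_(k+j), split after k and after j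
        factors.\<close>
      have "pochhammer (\<gamma> - x) k * pochhammer (\<gamma> - x + real k) j = pochhammer (\<gamma> - x) j * pochhammer (\<gamma> - x + real j) k"
        unfolding pochhammer_add_shift by (simp only: add.commute)
      then have 1: "pochhammer (\<gamma> - x) k * pochhammer (\<gamma> - x + real k) j / pochhammer (\<gamma> - x) j = pochhammer (\<gamma> - x + real j) k"
        using u by simp
      have 2: "pochhammer (- real n) k * pochhammer (- real (n - k)) j = pochhammer (- real n) (k + j)"
        using pochhammer_add_shift[of "- real n" k j] k by (simp add: of_nat_diff)
      have "pochhammer (\<gamma> + 1) n / fact n * ((1 / p) ^ k
         * (pochhammer (- real n) k * pochhammer (\<gamma> - x) k) / (pochhammer (\<gamma> + 1) k * pochhammer a k)
         * ((pochhammer (- real (n - k)) j * pochhammer (\<gamma> - x + real k) j * pochhammer (a - 1) j * pochhammer \<gamma> j)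
            / (pochhammer (\<gamma> - x) j * pochhammer (a + real k) j * pochhammer (\<gamma> + 1 + real k) j * fact j)))
        = pochhammer (\<gamma> + 1) n / fact n * (pochhammer (- real n) k * pochhammer (- real (n - k)) j)
          / ((pochhammer (\<gamma> + 1) k * pochhammer (\<gamma> + 1 + real k) j) * (pochhammer a k * pochhammer (a + real k) j))
          * ((1 / p) ^ k * (pochhammer (\<gamma> - x) k * pochhammer (\<gamma> - x + real k) j / pochhammer (\<gamma> - x) j) * ?r j)"
        by (simp only: times_divide_eq_left times_divide_eq_right divide_divide_eq_left mult_ac)
      also have "\<dots> = ?t k j"
        unfolding 1 2 unfolding pochhammer_add_shift krawtchouk_coeff_def ..
      finally show ?thesis .
    qed
    show ?thesis
      unfolding terminating_4F3_def sum_distrib_left pw atLeast0AtMost by (intro sum.cong refl summand) simp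
  qed
  have "pochhammer (\<gamma> + 1) n / fact n *
      (\<Sum>k=0..n. p powi (- int k)
         * (pochhammer (- real n) k * pochhammer (\<gamma> - x) k) / (pochhammer (\<gamma> + 1) k * pochhammer a k)
         * terminating_4F3 (n - k) (\<gamma> - x + real k) (a - 1) \<gamma> (\<gamma> - x) (a + real k) (\<gamma> + 1 + real k))
    = (\<Sum>k\<le>n. \<Sum>j\<le>n - k. ?t k j)"
    unfolding atLeast0AtMost unfolding sum_distrib_left[where A = "{..n}"] by (intro sum.cong refl inner) simp
  also have "\<dots> = (\<Sum>m\<le>n. \<Sum>j\<le>m. ?t (m - j) j)"
    unfolding sum.Sigma[OF finite_atMost ballI[OF finite_atMost]]
    by (rule sum.reindex_bij_witness[where i = "\<lambda>(m, j). (m - j, j)" and j = "\<lambda>(k, j). (k + j, j)"]) auto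
  also have "\<dots> = krawtchouk_sum p \<gamma> a n x"
    unfolding krawtchouk_sum_def krawtchouk_basis_def sum_distrib_left by (intro sum.cong) auto
  finally show ?thesis .
qed

section \<open>The explicit formula and its continuous extension\<close>

text \<open>Where some (\<gamma>-x)_j vanishes, \<open>R x\<close> contains divisions by zero. The
  punctured limit there ignores that value and expresses the convention of continuity.\<close>

theorem mainTheorem12:
  fixes \<gamma> p N :: real and n :: nat
  assumes "\<gamma> \<ge> 0"
    and "(p < 0 \<and> N - \<gamma> < 0)
       \<or> (0 < p \<and> p < 1 \<and> int n \<le> \<lfloor>N - \<gamma>\<rfloor>)
       \<or> (p > 1 \<and> N - \<gamma> < 0)"
  shows "let R = (\<lambda>x. pochhammer (\<gamma> + 1) n / fact n *
            (\<Sum>k=0..n. p powi (- int k)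
               * (pochhammer (- real n) k * pochhammer (\<gamma> - x) k)
               / (pochhammer (\<gamma> + 1) k * pochhammer (\<gamma> - N) k)
               * terminating_4F3 (n - k)
                   (\<gamma> - x + real k) (\<gamma> - N - 1) \<gamma>
                   (\<gamma> - x) (\<gamma> - N + real k) (\<gamma> + 1 + real k)))
         in \<forall>x. if \<forall>j\<le>n. pochhammer (\<gamma> - x) j \<noteq> 0
                then poly (assoc_krawtchouk p N \<gamma> n) x = R x
                else (R \<longlongrightarrow> poly (assoc_krawtchouk p N \<gamma> n) x) (at x)"
proof -
  define R where "R = (\<lambda>x. pochhammer (\<gamma> + 1) n / fact n *
            (\<Sum>k=0..n. p powi (- int k)
               * (pochhammer (- real n) k * pochhammer (\<gamma> - x) k)
               / (pochhammer (\<gamma> + 1) k * pochhammer (\<gamma> - N) k)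
               * terminating_4F3 (n - k)
                   (\<gamma> - x + real k) (\<gamma> - N - 1) \<gamma>
                   (\<gamma> - x) (\<gamma> - N + real k) (\<gamma> + 1 + real k)))"
  let ?K = "poly (assoc_krawtchouk p N \<gamma> n)"
  have p: "p \<noteq> 0" using assms(2) by auto
  \<comment> \<open>If N < \<gamma>, the sum is positive; in the case 0 < p < 1 it is negative, as i
    < n \<le> N - \<gamma>.\<close>
  have a: "\<gamma> - N + real i \<noteq> 0" if "i < n" for i
    using assms(2) that by (auto simp: le_floor_iff)
  have eq: "?K x = R x" if "\<forall>j\<le>n. pochhammer (\<gamma> - x) j \<noteq> 0" for x
    unfolding R_def using krawtchouk_sum_eq_4F3[of n \<gamma> x p "\<gamma> - N"] that
      poly_assoc_krawtchouk_eq_sum[OF p assms(1) a] by simp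
  have "(R \<longlongrightarrow> ?K x) (at x)" for x
  proof (rule Lim_transform_eventually)
    \<comment> \<open>The exceptional points are among the finitely many \<gamma> + i with i < n.
      Taking x out of them makes the complement an open neighbourhood of x, on which the formula
      holds away from x.\<close>
    let ?B = "(\<lambda>i. \<gamma> + real i) ` {..<n} - {x}"
    have "open (- ?B)"
      by (intro open_Compl finite_imp_closed) auto
    then have "\<forall>\<^sub>F y in at x. y \<in> - ?B"
      by (intro eventually_at_in_open') auto
    moreover have "\<forall>\<^sub>F y in at x. y \<noteq> x"
      by (rule eventually_neq_at_within)
    ultimately show "\<forall>\<^sub>F y in at x. ?K y = R y"
    proof eventually_elim
      case (elim y)
      show ?case
      proof (rule eq, intro allI impI notI)
        fix j assume "j \<le> n" "pochhammer (\<gamma> - y) j = 0"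
        then obtain i where "i < n" "\<gamma> - y = - real i"
          by (auto simp: pochhammer_eq_0_iff)
        then have "y = \<gamma> + real i" by simp
        then show False using elim \<open>i < n\<close> by auto
      qed
    qed
    show "(?K \<longlongrightarrow> ?K x) (at x)"
      by (intro tendsto_intros)
  qed
  then show ?thesis
    unfolding Let_def R_def[symmetric] using eq by auto
qed

end
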